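(* Let $R$ be an integral domain, and let $G^\ast$, $B$, $M$, $J_b$, $\vartriangle_a$ be as defined in the context. Then the following five conditions are equivalent. ($D_1$) For each $a\in G^\ast$, the supremum of $\downarrow a\cap B$ in $G^\ast$ exists and $a=\bigvee(\downarrow a\cap B)$. ($D_2$) For all $a\in G^\ast$ and $J\in M$: if $J\in\vartriangle_a$, then there is $b\in B$ such that $J\in\vartriangle_b$ and $J_b\in\vartriangle_a$. ($D_3$) For each $J\in M$, $J=\bigcap_{b\in B\setminus J}J_b$ (the empty intersection being $G^\ast$). ($D_4$) For each $J\in M$, $J=\bigvee_{b\in J\cap B}\downarrow b$, where the join is taken in $M$ ordered by inclusion (the empty join being the least element $\downarrow[1]$ of $M$). ($D_5$) Every nonzero element of $R$ can be written as a least common multiple of an infinite or finite number of powers of prime factors of that element in $R$ (by convention a unit is a least common multiple of the empty family of powers of prime factors).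
   Context: $R$ is an integral domain (commutative ring with $1\neq 0$, no zero divisors), $R^\ast=R\setminus\{0\}$, $U$ is the group of units of $R$, and $G^\ast=R^\ast/U$ is the ordered monoid of classes $[x]$ ($x\in R^\ast$), with $[x][y]=[xy]$ and $[x]\leqslant[y]$ iff $x$ divides $y$ in $R$. Joins $\vee$ (suprema) and meets $\wedge$ (infima) of elements of $G^\ast$ are with respect to $\leqslant$. For $a\in G^\ast$, $\downarrow a=\{c\in G^\ast\mid c\leqslant a\}$, and for $A\subseteq G^\ast$, $\downarrow A=\bigcup_{a\in A}\downarrow a$. $B=\{[p]^n\mid p\in R \text{ prime},\ n=1,2,\dots\}$. A nonempty subset $J\subseteq G^\ast$ is a $B$-ideal if $\downarrow J=J$ and, for each $a\in G^\ast$, whenever $\downarrow a\cap B\subseteq J$ and the supremum $\bigvee(\downarrow a\cap B)$ exists in $G^\ast$, then $\bigvee(\downarrow a\cap B)\in J$. $M$ is the collection of all $B$-ideals, ordered by inclusion; it is a complete lattice with meets given by intersections, least element $\downarrow[1]$ and greatest element $G^\ast$. For $b\in B$, $J_b=\{a\in G^\ast\mid b\not\leqslant a\}$, which is a $B$-ideal. For $a\in G^\ast$, $\vartriangle_a=\{J\in M\mid a\notin J\}$. *)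

theory Defs
  imports Main "HOL-Library.Lub_Glb" "HOL-Computational_Algebra.Factorial_Ring"
begin

text \<open>
  The integral domain is a type of class \<open>idom\<close>. The monoid of nonzero elements modulo units is a
  partial quotient: 0 lies outside the domain of the relation, so \<open>cls x\<close> is meaningful
  only for \<open>x \<noteq> 0\<close>.
\<close>

definition unit_rel :: "'a::idom \<Rightarrow> 'a \<Rightarrow> bool" where
  "unit_rel x y \<longleftrightarrow> x \<noteq> 0 \<and> y \<noteq> 0 \<and> (\<exists>u. u dvd 1 \<and> y = u * x)"

lemma unit_rel_iff: "unit_rel x y \<longleftrightarrow> x \<noteq> 0 \<and> y \<noteq> 0 \<and> x dvd y \<and> y dvd x"
proof
  assume "unit_rel x y"
  then obtain u where u: "x \<noteq> 0" "y \<noteq> 0" "u dvd 1" "y = u * x"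
    unfolding unit_rel_def by blast
  then obtain v where "1 = u * v" by (meson dvdE)
  then have "x = y * v" using u by (metis mult.assoc mult.commute mult_1)
  then show "x \<noteq> 0 \<and> y \<noteq> 0 \<and> x dvd y \<and> y dvd x" using u by auto
next
  assume a: "x \<noteq> 0 \<and> y \<noteq> 0 \<and> x dvd y \<and> y dvd x"
  then obtain u v where u: "y = x * u" and v: "x = y * v" by (meson dvdE)
  then have "x * (u * v) = x * 1" by (metis mult.assoc mult.right_neutral)
  then have "u * v = 1" using a by (metis mult_cancel_left)
  then have "u dvd 1" by (metis dvd_triv_left)
  then show "unit_rel x y" using a u unfolding unit_rel_def by (auto simp: mult.commute)
qed

quotient_type (overloaded) 'a gstar = "'a::idom" / partial: unit_rel
  morphisms rep_gstar cls
proof (rule part_equivpI)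
  show "\<exists>x::'a. unit_rel x x" by (rule exI[of _ 1]) (simp add: unit_rel_iff)
  show "symp (unit_rel :: 'a \<Rightarrow> _)" by (auto intro!: sympI simp: unit_rel_iff)
  show "transp (unit_rel :: 'a \<Rightarrow> _)"
    by (rule transpI) (auto simp: unit_rel_iff intro: dvd_trans)
qed

instantiation gstar :: (idom) comm_monoid_mult
begin

lift_definition one_gstar :: "'a gstar" is 1
  by (simp add: unit_rel_iff)

lift_definition times_gstar :: "'a gstar \<Rightarrow> 'a gstar \<Rightarrow> 'a gstar" is "(*)"
  by (auto simp: unit_rel_iff intro: mult_dvd_mono)

instance
  by standard (transfer, auto simp: unit_rel_iff mult_ac)+

end

instantiation gstar :: (idom) order
begin

lift_definition less_eq_gstar :: "'a gstar \<Rightarrow> 'a gstar \<Rightarrow> bool" is "(dvd)"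
  by (auto simp: unit_rel_iff intro: dvd_trans)

definition less_gstar :: "'a gstar \<Rightarrow> 'a gstar \<Rightarrow> bool" where
  "less_gstar a b \<longleftrightarrow> a \<le> b \<and> \<not> b \<le> a"

instance
proof
  fix a b c :: "'a gstar"
  show "a < b \<longleftrightarrow> a \<le> b \<and> \<not> b \<le> a" by (rule less_gstar_def)
  show "a \<le> a" by transfer simp
  show "a \<le> b \<Longrightarrow> b \<le> c \<Longrightarrow> a \<le> c" by transfer (rule dvd_trans)
  show "a \<le> b \<Longrightarrow> b \<le> a \<Longrightarrow> a = b" by transfer (simp add: unit_rel_iff)
qed

end

lemma cls_eq_iff:
  "x \<noteq> 0 \<Longrightarrow> y \<noteq> 0 \<Longrightarrow> cls x = cls y \<longleftrightarrow> (\<exists>u. u dvd 1 \<and> y = u * x)"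
  using Quotient_rel[OF Quotient_gstar, of x y] by (auto simp: unit_rel_iff unit_rel_def)

lemma cls_le_iff: "x \<noteq> 0 \<Longrightarrow> y \<noteq> 0 \<Longrightarrow> cls x \<le> cls y \<longleftrightarrow> x dvd y"
  by (rule less_eq_gstar.abs_eq) (simp_all add: unit_rel_iff)

lemma cls_mult: "x \<noteq> 0 \<Longrightarrow> y \<noteq> 0 \<Longrightarrow> cls x * cls y = cls (x * y)"
  by (rule times_gstar.abs_eq) (simp_all add: unit_rel_iff)

lemma cls_one: "cls 1 = 1"
  by (simp add: one_gstar_def)

lemma cls_cases: obtains x where "x \<noteq> 0" "a = cls x"
proof -
  have "unit_rel (rep_gstar a) (rep_gstar a)" by (rule Quotient_rep_reflp[OF Quotient_gstar])
  then show thesis using that Quotient_abs_rep[OF Quotient_gstar, of a]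
    by (auto simp: unit_rel_iff)
qed

definition prime_pows :: "'a::idom gstar set" where
  "prime_pows = {cls p ^ n | p n. prime_elem p \<and> n \<ge> 1}"

text \<open>
  \<open>isLub UNIV S s\<close> says that the supremum of \<open>S\<close> exists and equals \<open>s\<close>; \<open>{..a}\<close> is the set of
  all elements below \<open>a\<close>.
\<close>

definition B_ideal :: "'a::idom gstar set \<Rightarrow> bool" where
  "B_ideal J \<longleftrightarrow> J \<noteq> {} \<and> (\<Union>a\<in>J. {..a}) = J \<and>
     (\<forall>a. {..a} \<inter> prime_pows \<subseteq> J \<longrightarrow>
        (\<forall>s. isLub UNIV ({..a} \<inter> prime_pows) s \<longrightarrow> s \<in> J))"

definition B_ideals :: "'a::idom gstar set set" where
  "B_ideals = {J. B_ideal J}"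

definition J_at :: "'a::idom gstar \<Rightarrow> 'a gstar set" where
  "J_at b = {a. \<not> b \<le> a}"

definition avoiding :: "'a::idom gstar \<Rightarrow> 'a gstar set set" where
  "avoiding a = {J \<in> B_ideals. a \<notin> J}"

text \<open>
  The library's \<open>Lcm\<close> presupposes that all least common multiples exist and are normalised, which
  is not the case in an arbitrary domain; hence a relational version. For the empty set the
  least common multiples are exactly the units.
\<close>

definition is_lcm :: "'a::idom set \<Rightarrow> 'a \<Rightarrow> bool" where
  "is_lcm S m \<longleftrightarrow> (\<forall>s\<in>S. s dvd m) \<and> (\<forall>c. (\<forall>s\<in>S. s dvd c) \<longrightarrow> m dvd c)"

definition D1 :: "'a::idom itself \<Rightarrow> bool" where
  "D1 _ \<longleftrightarrow> (\<forall>a :: 'a gstar. isLub UNIV ({..a} \<inter> prime_pows) a)"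

definition D2 :: "'a::idom itself \<Rightarrow> bool" where
  "D2 _ \<longleftrightarrow> (\<forall>a :: 'a gstar. \<forall>J \<in> B_ideals. J \<in> avoiding a \<longrightarrow>
     (\<exists>b \<in> prime_pows. J \<in> avoiding b \<and> J_at b \<in> avoiding a))"

definition D3 :: "'a::idom itself \<Rightarrow> bool" where
  "D3 _ \<longleftrightarrow> (\<forall>J \<in> B_ideals :: 'a gstar set set. J = (\<Inter>b \<in> prime_pows - J. J_at b))"

text \<open>The join in \<open>D4\<close> is the least upper bound relative to \<open>B_ideals\<close>, ordered by inclusion.\<close>

definition D4 :: "'a::idom itself \<Rightarrow> bool" where
  "D4 _ \<longleftrightarrow> (\<forall>J \<in> B_ideals :: 'a gstar set set.
     isLub B_ideals ((\<lambda>b. {..b}) ` (J \<inter> prime_pows)) J)"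

definition D5 :: "'a::idom itself \<Rightarrow> bool" where
  "D5 _ \<longleftrightarrow> (\<forall>x :: 'a. x \<noteq> 0 \<longrightarrow>
     (\<exists>S. S \<subseteq> {p ^ n | p n. prime_elem p \<and> p dvd x \<and> n \<ge> 1} \<and> is_lcm S x))"

end

theory Submission imports Defs begin

text \<open>
  Two families of \<open>B\<close>-ideals do all the work: the principal ideals \<open>{..a}\<close>, through which an
  inequality \<open>a \<le> c\<close> becomes an inclusion of \<open>B\<close>-ideals, and the ideals \<open>J_at b\<close>, which are the
  largest lower sets that miss the prime power \<open>b\<close>; they are nonempty because \<open>b\<close> is not the class
  of a unit.

  The conditions are proved in the cycle \<open>D1\<close>, \<open>D2\<close>, \<open>D3\<close>, \<open>D4\<close>, \<open>D1\<close>. If every element is the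
  supremum of the prime powers below it, then a \<open>B\<close>-ideal that contains all prime powers below \<open>a\<close>
  contains \<open>a\<close>; so whenever \<open>a\<close> lies outside \<open>J\<close>, some prime power \<open>b \<le> a\<close> lies outside \<open>J\<close> as well,
  and \<open>J_at b\<close> separates \<open>J\<close> from \<open>a\<close>. Such separation says that \<open>J\<close> is the intersection of the
  ideals \<open>J_at b\<close> containing it. A \<open>B\<close>-ideal is then determined, monotonically, by the prime powers
  that it contains, which is the statement that it is the join of the corresponding principal
  ideals. Applied to the principal ideals themselves, this last statement returns the supremum
  formula for elements.

  Finally, \<open>D1\<close> and \<open>D5\<close> are the same assertion, read in the monoid of classes and in the ring: a
  common multiple of a family is an upper bound of the classes, and if \<open>x\<close> is a least common multiple
  of some family of prime powers, it is also one of the larger family of all prime powers dividing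
  \<open>x\<close>.
\<close>

section \<open>Powers of primes as classes and as ring elements\<close>

lemma isLub_UNIV_iff:
  "isLub UNIV S s \<longleftrightarrow> (\<forall>x\<in>S. x \<le> s) \<and> (\<forall>c. (\<forall>x\<in>S. x \<le> c) \<longrightarrow> s \<le> c)"
  by (auto simp: isLub_def leastP_def isUb_def setle_def setge_def)

lemma cls_power:
  fixes x :: "'a::idom"
  assumes "x \<noteq> 0"
  shows "cls x ^ n = cls (x ^ n)"
  using assms by (induction n) (simp_all add: cls_one cls_mult)

lemma prime_powsE:
  assumes "b \<in> prime_pows"
  obtains p :: "'a::idom" and n
  where "prime_elem p" "n \<ge> 1" "p ^ n \<noteq> 0" "b = cls (p ^ n)"
  using assms by (auto simp: prime_pows_def cls_power prime_elem_def)

lemma cls_prime_power_in_prime_pows: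
  "prime_elem p \<Longrightarrow> n \<ge> 1 \<Longrightarrow> cls (p ^ n) \<in> prime_pows"
  using cls_power[of p n] unfolding prime_pows_def
  by (metis (mono_tags, lifting) mem_Collect_eq prime_elem_def)

lemma prime_pow_not_le_one:
  assumes "b \<in> prime_pows"
  shows "\<not> b \<le> (1 :: 'a::idom gstar)"
proof
  assume "b \<le> 1"
  obtain p :: 'a and n where p: "prime_elem p" "n \<ge> 1" "p ^ n \<noteq> 0" "b = cls (p ^ n)"
    using assms by (rule prime_powsE)
  then have "p ^ n dvd 1" using \<open>b \<le> 1\<close> by (simp add: cls_le_iff flip: cls_one)
  moreover have "p dvd p ^ n" using p(2) by (simp add: dvd_power)
  ultimately have "p dvd 1" by (rule dvd_trans[rotated])
  then show False using p(1) by (simp add: prime_elem_def)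
qed

section \<open>The two basic families of \<open>B\<close>-ideals\<close>

lemma B_ideal_downward: "J \<in> B_ideals \<Longrightarrow> a \<in> J \<Longrightarrow> c \<le> a \<Longrightarrow> c \<in> J"
  unfolding B_ideals_def B_ideal_def by blast

lemma B_ideal_sup:
  "J \<in> B_ideals \<Longrightarrow> {..a} \<inter> prime_pows \<subseteq> J \<Longrightarrow> isLub UNIV ({..a} \<inter> prime_pows) s \<Longrightarrow> s \<in> J"
  unfolding B_ideals_def B_ideal_def by blast

lemma principal_in_B_ideals: "{..a} \<in> B_ideals"
proof -
  have "(\<Union>c\<in>{..a}. {..c}) = {..a}" by (auto intro: order_trans)
  moreover have "s \<in> {..a}"
    if "{..c} \<inter> prime_pows \<subseteq> {..a}" "isLub UNIV ({..c} \<inter> prime_pows) s" for c s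
    using that unfolding isLub_UNIV_iff by blast
  moreover have "{..a} \<noteq> {}" by auto
  ultimately show ?thesis unfolding B_ideals_def B_ideal_def by blast
qed

text \<open>
  The closure condition holds because the supremum in question never exceeds the element \<open>a\<close> that
  bounds the family: if it were above \<open>b\<close>, so would be \<open>a\<close>, and \<open>b\<close> itself would belong to the family.
\<close>

lemma J_at_in_B_ideals:
  fixes b :: "'a::idom gstar"
  assumes b: "b \<in> prime_pows"
  shows "J_at b \<in> B_ideals"
proof -
  have "1 \<in> J_at b" using prime_pow_not_le_one[OF b] by (simp add: J_at_def)
  moreover have "(\<Union>a\<in>J_at b. {..a}) = J_at b"
    by (auto simp: J_at_def intro: order_trans)
  moreover have "s \<in> J_at b"
    if sub: "{..a} \<inter> prime_pows \<subseteq> J_at b" and s: "isLub UNIV ({..a} \<inter> prime_pows) s" for a s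
  proof -
    have "s \<le> a" using s by (auto simp: isLub_UNIV_iff)
    moreover have "\<not> b \<le> a" using sub b by (auto simp: J_at_def)
    ultimately show ?thesis by (auto simp: J_at_def dest: order_trans)
  qed
  ultimately show ?thesis unfolding B_ideals_def B_ideal_def by blast
qed

lemma B_ideal_subset_J_at: "J \<in> B_ideals \<Longrightarrow> b \<notin> J \<Longrightarrow> J \<subseteq> J_at b"
  by (auto simp: J_at_def dest: B_ideal_downward)

section \<open>The cycle of order-theoretic conditions\<close>

lemma D1_imp_D2:
  assumes "D1 TYPE('a::idom)"
  shows "D2 TYPE('a)"
  unfolding D2_def
proof (intro allI ballI impI)
  fix a :: "'a gstar" and J
  assume J: "J \<in> B_ideals" and "J \<in> avoiding a"
  then have "a \<notin> J" by (simp add: avoiding_def)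
  moreover have "isLub UNIV ({..a} \<inter> prime_pows) a" using assms by (simp add: D1_def)
  ultimately have "\<not> {..a} \<inter> prime_pows \<subseteq> J" using B_ideal_sup[OF J] by blast
  then obtain b where b: "b \<in> prime_pows" "b \<le> a" "b \<notin> J" by auto
  then have "J \<in> avoiding b" "J_at b \<in> avoiding a"
    using J J_at_in_B_ideals[OF b(1)] by (auto simp: avoiding_def J_at_def)
  then show "\<exists>b\<in>prime_pows. J \<in> avoiding b \<and> J_at b \<in> avoiding a" using b(1) by blast
qed

lemma D2_imp_D3:
  assumes "D2 TYPE('a::idom)"
  shows "D3 TYPE('a)"
  unfolding D3_def
proof
  fix J :: "'a gstar set"
  assume J: "J \<in> B_ideals"
  have "J \<subseteq> (\<Inter>b \<in> prime_pows - J. J_at b)" using B_ideal_subset_J_at[OF J] by blast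
  moreover have "(\<Inter>b \<in> prime_pows - J. J_at b) \<subseteq> J"
    using assms J unfolding D2_def avoiding_def by blast
  ultimately show "J = (\<Inter>b \<in> prime_pows - J. J_at b)" by (rule equalityI)
qed

lemma D3_imp_D4:
  assumes "D3 TYPE('a::idom)"
  shows "D4 TYPE('a)"
  unfolding D4_def
proof
  fix J :: "'a gstar set"
  assume J: "J \<in> B_ideals"
  \<comment> \<open>By \<open>D3\<close> for \<open>K\<close>, inclusion in \<open>K\<close> is tested on prime powers alone.\<close>
  have "J \<subseteq> K" if K: "K \<in> B_ideals" and sub: "J \<inter> prime_pows \<subseteq> K" for K
  proof -
    have "J \<subseteq> (\<Inter>b \<in> prime_pows - K. J_at b)" using B_ideal_subset_J_at[OF J] sub by blast
    also have "\<dots> = K" using assms K unfolding D3_def by blast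
    finally show ?thesis .
  qed
  moreover have "J \<inter> prime_pows \<subseteq> K" if "\<forall>b\<in>J \<inter> prime_pows. {..b} \<subseteq> K" for K
    using that by auto
  moreover have "{..b} \<subseteq> J" if "b \<in> J" for b
    using J that by (auto dest: B_ideal_downward)
  ultimately show "isLub B_ideals ((\<lambda>b. {..b}) ` (J \<inter> prime_pows)) J"
    using J by (simp add: isLub_def leastP_def isUb_def setle_def setge_def)
qed

lemma D4_imp_D1:
  assumes "D4 TYPE('a::idom)"
  shows "D1 TYPE('a)"
  unfolding D1_def
proof
  fix a :: "'a gstar"
  have lub: "isLub B_ideals ((\<lambda>b. {..b}) ` ({..a} \<inter> prime_pows)) {..a}"
    using assms principal_in_B_ideals unfolding D4_def by blast
  have "a \<le> c" if c: "\<forall>b\<in>{..a} \<inter> prime_pows. b \<le> c" for c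
  proof -
    have "isUb B_ideals ((\<lambda>b. {..b}) ` ({..a} \<inter> prime_pows)) {..c}"
      using c by (simp add: isUb_def setle_def principal_in_B_ideals)
    with lub have "{..a} \<subseteq> {..c}" by (rule isLub_le_isUb)
    then show ?thesis by simp
  qed
  then show "isLub UNIV ({..a} \<inter> prime_pows) a" by (simp add: isLub_UNIV_iff)
qed

section \<open>Suprema of classes and least common multiples\<close>

lemma D1_imp_D5:
  assumes "D1 TYPE('a::idom)"
  shows "D5 TYPE('a)"
  unfolding D5_def
proof (intro allI impI)
  fix x :: 'a
  assume x: "x \<noteq> 0"
  define S where "S = {p ^ n | p n. prime_elem p \<and> p ^ n dvd x \<and> n \<ge> 1}"
  have "x dvd c" if c: "\<forall>s\<in>S. s dvd c" for c
  proof (cases "c = 0")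
    \<comment> \<open>The common multiple 0 has no class, so it is not seen by \<open>D1\<close>.\<close>
    case True
    then show ?thesis by simp
  next
    case False
    have "b \<le> cls c" if b: "b \<in> {..cls x} \<inter> prime_pows" for b
    proof -
      obtain p :: 'a and n where p: "prime_elem p" "n \<ge> 1" "p ^ n \<noteq> 0" "b = cls (p ^ n)"
        using b by (elim IntE prime_powsE)
      then have "p ^ n dvd x" using b x by (simp add: cls_le_iff)
      then have "p ^ n dvd c" using p c unfolding S_def by blast
      then show ?thesis using p False by (simp add: cls_le_iff)
    qed
    moreover have "isLub UNIV ({..cls x} \<inter> prime_pows) (cls x)"
      using assms unfolding D1_def by blast
    ultimately have "cls x \<le> cls c" unfolding isLub_UNIV_iff by blast
    then show ?thesis using x False by (simp add: cls_le_iff)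
  qed
  then have "is_lcm S x" unfolding is_lcm_def S_def by blast
  moreover have "S \<subseteq> {p ^ n | p n. prime_elem p \<and> p dvd x \<and> n \<ge> 1}"
  proof
    fix s
    assume "s \<in> S"
    then obtain p n where p: "s = p ^ n" "prime_elem p" "p ^ n dvd x" "n \<ge> 1"
      by (auto simp: S_def)
    moreover have "p dvd p ^ n" using p(4) by (simp add: dvd_power)
    then have "p dvd x" using p(3) by (rule dvd_trans)
    ultimately show "s \<in> {p ^ n | p n. prime_elem p \<and> p dvd x \<and> n \<ge> 1}" by blast
  qed
  ultimately show "\<exists>S. S \<subseteq> {p ^ n | p n. prime_elem p \<and> p dvd x \<and> n \<ge> 1} \<and> is_lcm S x"
    by blast
qed

lemma D5_imp_D1:
  assumes "D5 TYPE('a::idom)"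
  shows "D1 TYPE('a)"
  unfolding D1_def
proof
  fix a :: "'a gstar"
  obtain x where x: "x \<noteq> 0" "a = cls x" by (rule cls_cases)
  obtain S where S: "S \<subseteq> {p ^ n | p n. prime_elem p \<and> p dvd x \<and> n \<ge> 1}" "is_lcm S x"
    using assms x(1) unfolding D5_def by blast
  have "a \<le> c" if c: "\<forall>b\<in>{..a} \<inter> prime_pows. b \<le> c" for c
  proof -
    obtain y where y: "y \<noteq> 0" "c = cls y" by (rule cls_cases)
    have "s dvd y" if s: "s \<in> S" for s
    proof -
      have sx: "s dvd x" using S(2) s by (simp add: is_lcm_def)
      then have "s \<noteq> 0" using x(1) by auto
      have "cls s \<in> prime_pows" using S(1) s cls_prime_power_in_prime_pows by blast
      moreover have "cls s \<le> a" using sx \<open>s \<noteq> 0\<close> x by (simp add: cls_le_iff)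
      ultimately have "cls s \<le> cls y" using c y(2) by auto
      then show ?thesis using \<open>s \<noteq> 0\<close> y(1) by (simp add: cls_le_iff)
    qed
    then have "x dvd y" using S(2) by (simp add: is_lcm_def)
    then show ?thesis using x y by (simp add: cls_le_iff)
  qed
  then show "isLub UNIV ({..a} \<inter> prime_pows) a" by (simp add: isLub_UNIV_iff)
qed

section \<open>The equivalence\<close>

theorem theorem2p1:
  shows "(D1 TYPE('a::idom) \<longleftrightarrow> D2 TYPE('a)) \<and>
         (D2 TYPE('a) \<longleftrightarrow> D3 TYPE('a)) \<and>
         (D3 TYPE('a) \<longleftrightarrow> D4 TYPE('a)) \<and>
         (D4 TYPE('a) \<longleftrightarrow> D5 TYPE('a))"
  using D1_imp_D2 D2_imp_D3 D3_imp_D4 D4_imp_D1 D1_imp_D5 D5_imp_D1 by blast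

end
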